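(* Let $\gamma=-0.1$, $\zeta=1.1$, $g(x)=\gamma+(\zeta-\gamma)\sigma(x)$ and $h(x)=\mathrm{clip}\big(g(x),0,1\big)$ for $x\in\mathbb{R}$, and $\mathcal{L}=(\zeta-\gamma)/4$. Let $A,\tilde A$ be random matrices with values in $\mathbb{R}^{m\times n}$, defined on a common probability space. Fix an entry $(i,j)$ and assume $g(A_{ij})\in(0,1)$. Set $\tilde H_{ij}=h(\tilde A_{ij})$, $\Delta A_{ij}=\tilde A_{ij}-A_{ij}$, and define the margin to the nearest clipping boundary $$\delta_{ij}=\min\{g(A_{ij}),\,1-g(A_{ij})\}.$$ Then $$\mathbb{P}\big(\tilde H_{ij}\in\{0,1\}\big)\le \mathbb{P}\big(|\Delta A_{ij}|>\delta_{ij}/\mathcal{L}\big).$$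
   Context: $\sigma(x)=1/(1+e^{-x})$ is the sigmoid function. $\mathrm{clip}(y,0,1)=\min\{\max\{y,0\},1\}$. Deterministic matrices are allowed as a special case of random ones; the assumption $g(A_{ij})\in(0,1)$ is understood to hold surely (or almost surely). *)

theory Defs
  imports "HOL-Probability.Probability"
begin

definition sigmoid :: "real \<Rightarrow> real" where
  "sigmoid x = 1 / (1 + exp (- x))"

definition clip :: "real \<Rightarrow> real \<Rightarrow> real \<Rightarrow> real" where
  "clip y a b = min (max y a) b"

definition gamma0 :: real where
  "gamma0 = - 0.1"

definition zeta0 :: real where
  "zeta0 = 1.1"

definition g :: "real \<Rightarrow> real" where
  "g x = gamma0 + (zeta0 - gamma0) * sigmoid x"

definition h :: "real \<Rightarrow> real" where
  "h x = clip (g x) 0 1"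

definition Lip :: real where
  "Lip = (zeta0 - gamma0) / 4"

text \<open>Distance from \<open>g x\<close> to the nearest clipping boundary (for \<open>g x\<close> between 0 and 1).\<close>

definition margin :: "real \<Rightarrow> real" where
  "margin x = min (g x) (1 - g x)"

end

theory Submission
  imports Defs
begin

text \<open>Reaching the clipped region from \<open>g x \<in> {0<..<1}\<close> requires \<open>g\<close> to change by at least the
  margin. The map \<open>g\<close> is Lipschitz with constant \<open>Lip\<close>, and strictly so between distinct points, because
  the derivative \<open>\<sigma> (1 - \<sigma>)\<close> of the sigmoid equals \<open>1/4\<close> only at \<open>0\<close>. This strictness gives
  the strict inequality in the event on the right-hand side.\<close>

lemma sigmoid_eq_half_iff: "sigmoid x = 1 / 2 \<longleftrightarrow> x = 0"
proof -
  have "1 + exp (- x) \<noteq> 0"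
    by (smt (verit) exp_gt_zero)
  then show ?thesis
    by (auto simp: sigmoid_def field_simps)
qed

lemma has_real_derivative_sigmoid:
  "(sigmoid has_real_derivative sigmoid x * (1 - sigmoid x)) (at x)"
proof -
  have nz: "1 + exp (- x) \<noteq> 0"
    by (smt (verit) exp_gt_zero)
  have "((\<lambda>x. 1 / (1 + exp (- x))) has_real_derivative exp (- x) / (1 + exp (- x))\<^sup>2) (at x)"
    using nz by (auto intro!: derivative_eq_intros simp: power2_eq_square)
  moreover have "exp (- x) / (1 + exp (- x))\<^sup>2 = sigmoid x * (1 - sigmoid x)"
    using nz by (simp add: sigmoid_def field_simps power2_eq_square)
  moreover have "sigmoid = (\<lambda>x. 1 / (1 + exp (- x)))"
    by (simp add: fun_eq_iff sigmoid_def)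
  ultimately show ?thesis
    by simp
qed

text \<open>By the mean value theorem, the strict bound holds on any interval whose interior avoids
  0. An interval with 0 inside is split at 0 and the two strict bounds are added.\<close>

lemma sigmoid_diff_less:
  assumes "x < y"
  shows "sigmoid y - sigmoid x < (y - x) / 4"
proof -
  \<comment> \<open>The open interval matters: 0 may be an endpoint, since the mean value point
    \<open>z\<close> is interior.\<close>
  have away: "sigmoid b - sigmoid a < (b - a) / 4" if "a < b" "0 \<notin> {a<..<b}" for a b
  proof -
    obtain z where z: "a < z" "z < b"
      and eq: "sigmoid b - sigmoid a = (b - a) * (sigmoid z * (1 - sigmoid z))"
      using MVT2[OF \<open>a < b\<close>, of sigmoid "\<lambda>x. sigmoid x * (1 - sigmoid x)"]
        has_real_derivative_sigmoid by blast
    have "sigmoid z - 1 / 2 \<noteq> 0"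
      using z that sigmoid_eq_half_iff[of z] by auto
    \<comment> \<open>Completing the square:
      \<open>s * (1 - s) = 1 / 4 - (s - 1 / 2)\<^sup>2\<close>.\<close>
    then have "(sigmoid z - 1 / 2)\<^sup>2 > 0"
      by simp
    then have "sigmoid z * (1 - sigmoid z) < 1 / 4"
      by (simp add: power2_eq_square algebra_simps)
    then have "(b - a) * (sigmoid z * (1 - sigmoid z)) < (b - a) * (1 / 4)"
      using that(1) by (intro mult_strict_left_mono) auto
    then show ?thesis
      using eq by simp
  qed
  show ?thesis
  proof (cases "0 \<in> {x<..<y}")
    case True
    then show ?thesis
      using away[of x 0] away[of 0 y] by simp
  next
    case False
    then show ?thesis
      using away[OF assms] by simp
  qed
qed

text \<open>Monotonicity fixes the sign of a difference of sigmoids, so that the one-sided bound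
  passes to absolute values.\<close>

lemma sigmoid_less_iff: "sigmoid x < sigmoid y \<longleftrightarrow> x < y"
proof -
  have "0 < 1 + exp (- x)" "0 < 1 + exp (- y)"
    by (simp_all add: add_pos_pos)
  then show ?thesis
    by (simp add: sigmoid_def field_simps)
qed

lemma abs_sigmoid_diff_less:
  assumes "x \<noteq> y"
  shows "\<bar>sigmoid x - sigmoid y\<bar> < \<bar>x - y\<bar> / 4"
proof (cases "x < y")
  case True
  then show ?thesis
    using sigmoid_diff_less[of x y] sigmoid_less_iff[of x y] by auto
next
  case False
  then show ?thesis
    using assms sigmoid_diff_less[of y x] sigmoid_less_iff[of y x] by auto
qed

lemma Lip_pos: "0 < Lip"
  by (simp add: Lip_def gamma0_def zeta0_def)

lemma abs_g_diff_less:
  assumes "x \<noteq> y"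
  shows "\<bar>g x - g y\<bar> < Lip * \<bar>x - y\<bar>"
proof -
  have "\<bar>g x - g y\<bar> = (zeta0 - gamma0) * \<bar>sigmoid x - sigmoid y\<bar>"
    by (simp add: g_def gamma0_def zeta0_def abs_if)
  also have "\<dots> < (zeta0 - gamma0) * (\<bar>x - y\<bar> / 4)"
    using abs_sigmoid_diff_less[OF assms]
    by (intro mult_strict_left_mono) (auto simp: gamma0_def zeta0_def)
  finally show ?thesis
    by (simp add: Lip_def)
qed

lemma h_eq_iff: "h x \<in> {0, 1} \<longleftrightarrow> g x \<le> 0 \<or> 1 \<le> g x"
  by (auto simp: h_def clip_def min_def max_def)

text \<open>This is the inclusion of events at a single sample point, with \<open>x\<close> and
  \<open>y\<close> as the original and the perturbed entry.\<close>

lemma margin_less_if_clipped: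
  assumes "g x \<in> {0<..<1}" and "h y \<in> {0, 1}"
  shows "margin x / Lip < \<bar>y - x\<bar>"
proof -
  have y: "g y \<le> 0 \<or> 1 \<le> g y"
    using assms(2) h_eq_iff by blast
  then have "y \<noteq> x"
    using assms(1) by auto
  \<comment> \<open>If \<open>g y \<le> 0\<close>, the change is at least \<open>g x\<close>; if
    \<open>1 \<le> g y\<close>, it is at least \<open>1 - g x\<close>.\<close>
  have "margin x \<le> \<bar>g y - g x\<bar>"
    using y assms(1) by (auto simp: margin_def)
  also have "\<dots> < Lip * \<bar>y - x\<bar>"
    by (rule abs_g_diff_less[OF \<open>y \<noteq> x\<close>])
  finally show ?thesis
    using Lip_pos by (simp add: field_simps)
qed

lemma borel_measurable_margin [measurable]: "margin \<in> borel_measurable borel"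
  unfolding margin_def[abs_def] g_def sigmoid_def by measurable

text \<open>Entry projections are continuous, hence Borel. Together with the measurability of
  \<open>margin\<close> this makes the right-hand event of the theorem measurable.\<close>

lemma borel_measurable_matrix_entry:
  fixes A :: "'w \<Rightarrow> real ^ 'n ^ 'm"
  assumes "A \<in> borel_measurable M"
  shows "(\<lambda>\<omega>. A \<omega> $ i $ j) \<in> borel_measurable M"
proof -
  have "(\<lambda>X :: real ^ 'n ^ 'm. X $ i $ j) \<in> borel_measurable borel"
    by (intro borel_measurable_continuous_onI continuous_intros)
  then show ?thesis
    by (rule measurable_compose[OF assms])
qed

theorem corollary2:
  fixes M :: "'w measure"
    and A A' :: "'w \<Rightarrow> real ^ 'n ^ 'm"
    and i :: 'm and j :: 'n
  assumes "prob_space M"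
    and "A \<in> borel_measurable M"
    and "A' \<in> borel_measurable M"
    and "AE \<omega> in M. g (A \<omega> $ i $ j) \<in> {0<..<1}"
  shows "\<P>(\<omega> in M. h (A' \<omega> $ i $ j) \<in> {0, 1})
    \<le> \<P>(\<omega> in M. \<bar>A' \<omega> $ i $ j - A \<omega> $ i $ j\<bar> > margin (A \<omega> $ i $ j) / Lip)"
proof -
  interpret prob_space M by fact
  note [measurable] = borel_measurable_matrix_entry[OF assms(2)] borel_measurable_matrix_entry[OF assms(3)]
  show ?thesis
  \<comment> \<open>Inclusion outside a null set suffices, which matches the almost sure hypothesis
    on \<open>A\<close>.\<close>
  proof (rule finite_measure_mono_AE)
    show "AE \<omega> in M. \<omega> \<in> {\<omega> \<in> space M. h (A' \<omega> $ i $ j) \<in> {0, 1}} \<longrightarrow>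
        \<omega> \<in> {\<omega> \<in> space M. \<bar>A' \<omega> $ i $ j - A \<omega> $ i $ j\<bar> > margin (A \<omega> $ i $ j) / Lip}"
      using assms(4) by eventually_elim (use margin_less_if_clipped in blast)
  qed measurable
qed

end
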